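(* Let $p=(12,R)$ be the mesh pattern with $R=\{(0,0),(0,1),(0,2),(1,0),(1,2),(2,0),(2,1)\}$. Let $F(x)=\sum_{n\ge0}n!\,x^n$ and $F(x,q)=\sum_{n\ge 0}x^n\sum_{\pi\in S_n}q^{p(\pi)}$. Then, as formal power series in $x$, $$F(x,q)=\left(1-x + \frac{x}{1+x(1-q)F(x)}\right)F(x).$$
   Context: $S_n$ is the set of permutations $\pi=\pi_1\cdots\pi_n$ of $\{1,\dots,n\}$ ($S_0$ contains only the empty permutation). A mesh pattern $(12,R)$ consists of the permutation $12$ and a set $R\subseteq\{0,1,2\}\times\{0,1,2\}$ of shaded boxes. An occurrence of $(12,R)$ in $\pi\in S_n$ is a pair of positions $s<t$ with $\pi_s<\pi_t$ such that, putting $s_0=0,\ s_1=s,\ s_2=t,\ s_3=n+1$ and $v_0=0,\ v_1=\pi_s,\ v_2=\pi_t,\ v_3=n+1$, for every $(i,j)\in R$ there is no position $m$ with $s_i<m<s_{i+1}$ and $v_j<\pi_m<v_{j+1}$. $p(\pi)$ is the number of occurrences of $p$ in $\pi$. *)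

theory Defs
  imports
    "HOL-Combinatorics.Permutations"
    "HOL-Computational_Algebra.Formal_Power_Series"
begin

(* Permutations of {1..n} are functions p with "p permutes {1..n}" (the identity outside {1..n}),
   p m being the m-th letter of the one-line notation.

   The shaded set R of a mesh pattern (12, R) is meant to satisfy R \<subseteq> {0,1,2} \<times> {0,1,2}.
   The four-element lists are (s_0, s_1, s_2, s_3) and (v_0, v_1, v_2, v_3). *)

definition mesh12_occurrence ::
  "(nat \<times> nat) set \<Rightarrow> nat \<Rightarrow> (nat \<Rightarrow> nat) \<Rightarrow> nat \<Rightarrow> nat \<Rightarrow> bool" where
  "mesh12_occurrence R n p s t \<longleftrightarrow>
     1 \<le> s \<and> s < t \<and> t \<le> n \<and> p s < p t \<and>
     (\<forall>(i, j) \<in> R.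
        \<not> (\<exists>m \<in> {1..n}.
             [0, s, t, n + 1] ! i < m \<and> m < [0, s, t, n + 1] ! (i + 1) \<and>
             [0, p s, p t, n + 1] ! j < p m \<and> p m < [0, p s, p t, n + 1] ! (j + 1)))"

definition mesh12_count :: "(nat \<times> nat) set \<Rightarrow> nat \<Rightarrow> (nat \<Rightarrow> nat) \<Rightarrow> nat" where
  "mesh12_count R n p = card {(s, t). mesh12_occurrence R n p s t}"

definition fact_fps :: "'a::comm_ring_1 fps" where
  "fact_fps = Abs_fps (\<lambda>n. of_nat (fact n))"

(* Here q is an arbitrary element of the coefficient ring; the generating function with q an
   indeterminate is the instance where q is the indeterminate of a ring of polynomials or field
   of rational functions. *)

definition mesh12_fps :: "(nat \<times> nat) set \<Rightarrow> 'a::comm_ring_1 \<Rightarrow> 'a fps" where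
  "mesh12_fps R q = Abs_fps (\<lambda>n. \<Sum>p | p permutes {1..n}. q ^ mesh12_count R n p)"

end

theory Submission
  imports Defs
begin

text \<open>
  The shading is so restrictive that an occurrence is determined by its second position. The shaded
  left column forces the first point to be the first letter, and the shaded boxes in the bottom row
  force that letter to be \<open>1\<close>. The remaining boxes then say that the second point \<open>(t, p t)\<close> has only
  smaller letters before it and only larger letters after it, so that \<open>p t = t\<close> and \<open>p\<close> maps
  \<open>{1..<t}\<close> onto itself. Hence a permutation that does not start with \<open>1\<close> has no occurrence; these
  contribute \<open>F - x F\<close>, where \<open>F = \<Sum>n. n! x\<^sup>n\<close>. Let \<open>H\<close> be the contribution of the others, so that
  \<open>F(x, q) = F - x F + H\<close>.

  The series \<open>H\<close> satisfies a linear equation. If \<open>D\<close> is the set of occurrences in a permutation, then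
  telescoping the powers of \<open>q\<close> along the increasing enumeration of \<open>D\<close> gives
  \<open>q ^ card D = 1 + (q - 1) * (\<Sum>k\<in>D. q ^ card {j \<in> D. j < k})\<close>.
  Summed over all permutations starting with \<open>1\<close>, the constant term yields \<open>x F\<close>. In the other term,
  a permutation together with a chosen occurrence is the same as a shorter permutation starting with
  \<open>1\<close> (the letters before \<open>t\<close>), the fixed point \<open>t\<close>, and an arbitrary permutation of the positions
  after \<open>t\<close>; the occurrences before the chosen one are exactly those of the first piece. This is the
  product \<open>H * x * F\<close>, and so \<open>H = x F + (q - 1) x F H\<close>. Solving for \<open>H\<close> gives the claim.
\<close>

section \<open>Permutations preserving a block\<close>

text \<open>
  A permutation of \<open>A \<union> B\<close> that preserves \<open>A\<close> also preserves \<open>B\<close>, so it can be cut into its two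
  restrictions and recovered by composing them. Since a permutation of \<open>B\<close> is the identity outside \<open>B\<close>, the pieces
  need no relabelling, even when \<open>B\<close> is an interval that does not begin at \<open>1\<close>.
\<close>

lemma bij_betw_compose_disjoint_permutes:
  assumes disj: "A \<inter> B = {}"
  shows "bij_betw (\<lambda>(a, b). a \<circ> b) ({a. a permutes A} \<times> {b. b permutes B})
           {p. p permutes A \<union> B \<and> p ` A = A}"
proof (rule bij_betw_byWitness[where f' = "\<lambda>p. (restrict_id p A, restrict_id p B)"])
  have on_A: "(a \<circ> b) x = a x" if "b permutes B" "x \<in> A" for a b :: "'a \<Rightarrow> 'a" and x
  proof -
    have "x \<notin> B" using disj that by auto
    then show ?thesis using permutes_not_in[OF that(1)] by simp
  qed
  have on_B: "(a \<circ> b) x = b x" if "a permutes A" "b permutes B" "x \<in> B"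
    for a b :: "'a \<Rightarrow> 'a" and x
  proof -
    have "b x \<notin> A" using disj that permutes_in_image[OF that(2), of x] by auto
    then show ?thesis using permutes_not_in[OF that(1)] by simp
  qed
  have compose: "a \<circ> b permutes A \<union> B \<and> (a \<circ> b) ` A = A"
    if a: "a permutes A" and b: "b permutes B" for a b
  proof -
    have "(a \<circ> b) ` A = a ` A"
      by (rule image_cong) (use on_A[OF b] in auto)
    then show ?thesis
      using a b by (metis permutes_compose permutes_image permutes_subset sup_ge1 sup_ge2)
  qed
  have image_B: "p ` B = B" if "p permutes A \<union> B" "p ` A = A" for p
  proof -
    have "p ` B = p ` (A \<union> B) - p ` A"
      using disj permutes_inj[OF that(1)] by (auto simp: inj_def)
    then show ?thesis using that disj permutes_image[OF that(1)] by auto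
  qed
  have restrict: "restrict_id p A permutes A" "restrict_id p B permutes B"
    if p: "p permutes A \<union> B" "p ` A = A" for p
    using p image_B[OF p] permutes_inj_on[OF p(1)]
    by (auto intro!: permutes_restrict_id simp: bij_betw_def)
  have glue: "restrict_id p A \<circ> restrict_id p B = p"
    if p: "p permutes A \<union> B" "p ` A = A" for p
  proof
    fix x
    show "(restrict_id p A \<circ> restrict_id p B) x = p x"
    proof (cases "x \<in> B")
      case True
      then have "p x \<in> B" using image_B[OF p] by auto
      then have "p x \<notin> A" using disj by auto
      then show ?thesis using True by (simp add: restrict_id_def)
    next
      case False
      then show ?thesis using permutes_not_in[OF p(1), of x] by (auto simp: restrict_id_def)
    qed
  qed
  have "restrict_id (a \<circ> b) A = a" "restrict_id (a \<circ> b) B = b"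
    if "a permutes A" "b permutes B" for a b
    using on_A[OF that(2), of _ a] on_B[OF that] permutes_not_in[OF that(1)] permutes_not_in[OF that(2)]
    by (auto simp: restrict_id_def fun_eq_iff)
  then show "\<forall>x \<in> {a. a permutes A} \<times> {b. b permutes B}.
      (restrict_id ((\<lambda>(a, b). a \<circ> b) x) A, restrict_id ((\<lambda>(a, b). a \<circ> b) x) B) = x"
    by auto
  show "(\<lambda>(a, b). a \<circ> b) ` ({a. a permutes A} \<times> {b. b permutes B})
      \<subseteq> {p. p permutes A \<union> B \<and> p ` A = A}"
    by (intro image_subsetI) (clarify, use compose in blast)
  show "\<forall>p \<in> {p. p permutes A \<union> B \<and> p ` A = A}.
      (\<lambda>(a, b). a \<circ> b) (restrict_id p A, restrict_id p B) = p"
    using glue by auto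
  show "(\<lambda>p. (restrict_id p A, restrict_id p B)) ` {p. p permutes A \<union> B \<and> p ` A = A}
      \<subseteq> {a. a permutes A} \<times> {b. b permutes B}"
    using restrict by auto
qed

lemma permutes_and_fixes_iff:
  assumes "B \<subseteq> A"
  shows "p permutes A \<and> (\<forall>x \<in> A - B. p x = x) \<longleftrightarrow> p permutes B"
  using assms by (auto intro: permutes_superset permutes_subset dest: permutes_not_in)

section \<open>Occurrences as split points\<close>

text \<open>
  An occurrence with second position \<open>t\<close> is recorded by \<open>k = t - 1\<close>, the length of the preserved
  prefix. This makes \<open>k\<close> the size of the left piece when the permutation is cut there. The value
  \<open>k = 0\<close> is left out because \<open>t = 1\<close> is already the first point of the occurrence.
\<close>

definition split_points :: "nat \<Rightarrow> (nat \<Rightarrow> nat) \<Rightarrow> nat set" where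
  "split_points n p = {k \<in> {1..<n}. p ` {1..k} = {1..k} \<and> p (Suc k) = Suc k}"

text \<open>
  Only the boxes \<open>(1,1)\<close> and \<open>(2,2)\<close> are unshaded, so the points other than the occurrence lie in two
  blocks along the diagonal, and counting pins down their sizes: the positions before \<open>t\<close> are mapped
  below \<open>p t\<close>, which by injectivity gives \<open>t \<le> p t\<close>, and the positions after \<open>t\<close> are mapped above
  \<open>p t\<close>, which gives \<open>p t \<le> t\<close>.
\<close>

lemma mesh12_occurrence_iff_split_point:
  assumes R: "R = {(0,0), (0,1), (0,2), (1,0), (1,2), (2,0), (2,1)}"
    and p: "p permutes {1..n}"
  shows "mesh12_occurrence R n p s t \<longleftrightarrow>
    s = 1 \<and> p 1 = 1 \<and> t \<in> Suc ` split_points n p"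
proof
  assume occ: "mesh12_occurrence R n p s t"
  then have st: "1 \<le> s" "s < t" "t \<le> n" "p s < p t"
    by (auto simp: mesh12_occurrence_def)
  have empty: "\<not> (\<exists>m \<in> {1..n}. [0, s, t, n + 1] ! i < m \<and> m < [0, s, t, n + 1] ! (i + 1) \<and>
             [0, p s, p t, n + 1] ! j < p m \<and> p m < [0, p s, p t, n + 1] ! (j + 1))"
    if "(i, j) \<in> R" for i j
    using occ that unfolding mesh12_occurrence_def by blast
  have col0: "\<not> (0 < m \<and> m < s \<and> 0 < p m \<and> p m < p s)"
      "\<not> (0 < m \<and> m < s \<and> p s < p m \<and> p m < p t)"
      "\<not> (0 < m \<and> m < s \<and> p t < p m \<and> p m < n + 1)" if "m \<in> {1..n}" for m
    using empty[of 0 0] empty[of 0 1] empty[of 0 2] that by (auto simp: R eval_nat_numeral)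
  have col1: "\<not> (s < m \<and> m < t \<and> 0 < p m \<and> p m < p s)"
      "\<not> (s < m \<and> m < t \<and> p t < p m \<and> p m < n + 1)" if "m \<in> {1..n}" for m
    using empty[of 1 0] empty[of 1 2] that by (auto simp: R eval_nat_numeral)
  have col2: "\<not> (t < m \<and> m < n + 1 \<and> 0 < p m \<and> p m < p s)"
      "\<not> (t < m \<and> m < n + 1 \<and> p s < p m \<and> p m < p t)" if "m \<in> {1..n}" for m
    using empty[of 2 0] empty[of 2 1] that by (auto simp: R eval_nat_numeral)
  have range: "1 \<le> p m \<and> p m \<le> n" if "m \<in> {1..n}" for m
    using permutes_in_image[OF p, of m] that by auto
  have inj: "p m = p m' \<longleftrightarrow> m = m'" for m m'
    using permutes_inj[OF p] by (auto dest: injD)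
  \<comment> \<open>Otherwise position 1 would lie in the left column, which is shaded in all three rows.\<close>
  have s: "s = 1"
  proof (rule ccontr)
    assume "s \<noteq> 1"
    with st have m: "1 \<in> {1..n}" "1 < s" by auto
    with col0[of 1] range[of 1] inj[of 1 s] inj[of 1 t] st show False by auto
  qed
  obtain m where m: "m \<in> {1..n}" "p m = 1"
    using permutes_image[OF p] st by (metis atLeastAtMost_iff imageE le_refl le_trans less_imp_le)
  \<comment> \<open>Otherwise the letter 1 would lie in the bottom row, which is shaded in all three columns.\<close>
  have p1: "p 1 = 1"
  proof (rule ccontr)
    assume "p 1 \<noteq> 1"
    then have "m \<noteq> 1" "1 < p 1" using m range[of 1] st by auto
    with m st s have "m > 1" "m \<noteq> t" "1 < p s" by auto
    with col1(1)[of m] col2(1)[of m] m s show False by auto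
  qed
  have below: "p ` {1..<t} \<subseteq> {1..<p t}"
  proof clarify
    fix m assume m: "m \<in> {1..<t}"
    with st have m': "m \<in> {1..n}" by auto
    show "p m \<in> {1..<p t}"
    proof (cases "m = s")
      case False
      then show ?thesis using col1(2)[OF m'] range[OF m'] inj[of m t] m s by auto
    qed (use st range[OF m'] in auto)
  qed
  have above: "p ` {t<..n} \<subseteq> {p t<..n}"
  proof clarify
    fix m assume m: "m \<in> {t<..n}"
    with st have m': "m \<in> {1..n}" by auto
    show "p m \<in> {p t<..n}"
      using col2[OF m'] range[OF m'] inj[of m t] inj[of m s] m s st p1 by auto
  qed
  have inj_on: "inj_on p M" for M
    using inj by (auto simp: inj_on_def)
  have "card {1..<t} \<le> card {1..<p t}" "card {t<..n} \<le> card {p t<..n}"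
    using card_inj_on_le[OF inj_on below] card_inj_on_le[OF inj_on above] by auto
  then have pt: "p t = t" using range[of t] st by auto
  have "p ` {1..<t} = {1..<t}"
    by (rule card_subset_eq) (use below pt card_image[OF inj_on] in auto)
  moreover obtain k where k: "t = Suc k" using st by (cases t) auto
  moreover have "{1..<Suc k} = {1..k}" by auto
  ultimately have "k \<in> split_points n p"
    using pt st s by (auto simp: split_points_def)
  with s p1 k show "s = 1 \<and> p 1 = 1 \<and> t \<in> Suc ` split_points n p" by auto
next
  assume "s = 1 \<and> p 1 = 1 \<and> t \<in> Suc ` split_points n p"
  then obtain k where "s = 1" "p 1 = 1" and k: "s = 1" "p 1 = 1" "t = Suc k" "1 \<le> k" "k < n"
      "p ` {1..k} = {1..k}" "p (Suc k) = Suc k"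
    by (auto simp: split_points_def)
  have inj: "p m = p m' \<longleftrightarrow> m = m'" for m m'
    using permutes_inj[OF p] by (auto dest: injD)
  have middle: "1 < p m \<and> p m < t" if "1 < m" "m < t" for m
  proof -
    have "p m \<in> {1..k}" using k that by (metis atLeastAtMost_iff imageI less_Suc_eq_le less_imp_le)
    then show ?thesis using inj[of m 1] k that by auto
  qed
  have right: "t < p m" if "t < m" "m \<le> n" for m
  proof (rule ccontr)
    assume "\<not> t < p m"
    moreover have "1 \<le> p m" using permutes_in_image[OF p, of m] that by auto
    moreover have "p m \<noteq> t" using inj[of m t] k that by auto
    ultimately have "p m \<in> p ` {1..k}" using k by auto
    then show False using that k inj_image_mem_iff[OF permutes_inj[OF p]] by auto
  qed
  have "p t = t" "1 < t" "t \<le> n" using k by auto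
  have "\<not> (1 < m \<and> m < t \<and> p m < 1)" "\<not> (1 < m \<and> m < t \<and> t < p m)"
    "\<not> (t < m \<and> m \<le> n \<and> p m < t)" for m
    using middle[of m] right[of m] by auto
  then show "mesh12_occurrence R n p s t"
    unfolding mesh12_occurrence_def R \<open>s = 1\<close> \<open>p 1 = 1\<close> \<open>p t = t\<close>
    using \<open>1 < t\<close> \<open>t \<le> n\<close> by (auto simp: numeral_2_eq_2)
qed

lemma mesh12_count_eq_card_split_points:
  assumes "R = {(0,0), (0,1), (0,2), (1,0), (1,2), (2,0), (2,1)}"
    and "p permutes {1..n}"
  shows "mesh12_count R n p = (if p 1 = 1 then card (split_points n p) else 0)"
proof -
  have "{(s, t). mesh12_occurrence R n p s t} =
      (if p 1 = 1 then (\<lambda>k. (1, Suc k)) ` split_points n p else {})"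
    using mesh12_occurrence_iff_split_point[OF assms] by auto
  then show ?thesis
    by (simp add: mesh12_count_def card_image inj_on_def)
qed

section \<open>The recurrence for permutations starting with 1\<close>

text \<open>
  The condition \<open>1 \<le> n\<close> excludes the empty permutation: it is represented by the identity function,
  which satisfies \<open>p 1 = 1\<close> although there is no first letter.
\<close>

definition perms_fixing_1 :: "nat \<Rightarrow> (nat \<Rightarrow> nat) set" where
  "perms_fixing_1 n = {p. p permutes {1..n} \<and> 1 \<le> n \<and> p 1 = 1}"

definition split_fps :: "'a::comm_ring_1 \<Rightarrow> 'a fps" where
  "split_fps q = Abs_fps (\<lambda>n. \<Sum>p \<in> perms_fixing_1 n. q ^ card (split_points n p))"

lemma finite_perms_fixing_1: "finite (perms_fixing_1 n)"
  by (rule finite_subset[OF _ finite_permutations[of "{1..n}"]]) (auto simp: perms_fixing_1_def)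

lemma card_perms_fixing_1: "card (perms_fixing_1 n) = (if n = 0 then 0 else fact (n - 1))"
proof (cases "n = 0")
  case False
  then have "{1..n} - {2..n} = {1}" by auto
  then have "perms_fixing_1 n = {p. p permutes {2..n}}"
    using False permutes_and_fixes_iff[of "{2..n}" "{1..n}"] by (auto simp: perms_fixing_1_def)
  then show ?thesis using False by (simp add: card_permutations)
qed (simp add: perms_fixing_1_def)

text \<open>
  Adding a new largest element to \<open>D\<close> multiplies the left side by \<open>q\<close>, which is an increase of
  \<open>(q - 1) * q ^ card D\<close>. On the right this is the new summand, and the old summands do not change
  because they look only at smaller elements. The lemma trades the weight of all occurrences for a sum
  over one marked occurrence, at which a permutation can be cut.
\<close>

lemma power_card_eq_sum_power_card_less:
  fixes q :: "'a::comm_ring_1" and D :: "'b::linorder set"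
  assumes "finite D"
  shows "q ^ card D = 1 + (q - 1) * (\<Sum>k\<in>D. q ^ card {j \<in> D. j < k})"
  using assms
proof (induction rule: finite_linorder_max_induct)
  case (insert b A)
  then have "b \<notin> A" by auto
  have "{j \<in> insert b A. j < b} = A" using insert by auto
  moreover have "{j \<in> insert b A. j < k} = {j \<in> A. j < k}" if "k \<in> A" for k
    using insert(2) that by force
  ultimately have "(\<Sum>k\<in>insert b A. q ^ card {j \<in> insert b A. j < k}) =
      q ^ card A + (\<Sum>k\<in>A. q ^ card {j \<in> A. j < k})"
    using \<open>b \<notin> A\<close> insert(1) by simp
  moreover have "q ^ card (insert b A) = q ^ card A + (q - 1) * q ^ card A"
    using \<open>b \<notin> A\<close> insert(1) by (simp add: algebra_simps)
  ultimately show ?case using insert.IH by (simp add: algebra_simps)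
qed simp

text \<open>
  A permutation with split point \<open>k\<close> fixes \<open>k + 1\<close>, hence permutes the two blocks \<open>{1..k}\<close> and
  \<open>{k+2..n}\<close> separately. The weight depends on the left block alone, so the right block contributes
  only the number of its permutations.
\<close>

lemma sum_perms_split_at:
  fixes q :: "'a::comm_ring_1"
  assumes "1 \<le> k" "k < n"
  shows "(\<Sum>p | p \<in> perms_fixing_1 n \<and> k \<in> split_points n p.
            q ^ card {j \<in> split_points n p. j < k}) =
    (\<Sum>a \<in> perms_fixing_1 k. q ^ card (split_points k a)) * of_nat (fact (n - k - 1))"
    (is "sum ?w ?L = ?r")
proof -
  let ?A = "{1..k}" and ?B = "{k+2..n}"
  let ?dom = "perms_fixing_1 k \<times> {b. b permutes ?B}"
  have agree: "(a \<circ> b) x = a x" if "b permutes ?B" "x \<le> k" for a b :: "nat \<Rightarrow> nat" and x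
    using that permutes_not_in[of b ?B x] by auto
  have "{1..n} - (?A \<union> ?B) = {Suc k}" "?A \<union> ?B \<subseteq> {1..n}" using assms by auto
  then have L: "?L = {p. p permutes ?A \<union> ?B \<and> p ` ?A = ?A} \<inter> {p. p 1 = 1}"
    using assms permutes_and_fixes_iff[of "?A \<union> ?B" "{1..n}"]
    by (auto simp: perms_fixing_1_def split_points_def)
  have bij: "bij_betw (\<lambda>(a, b). a \<circ> b) ({a. a permutes ?A} \<times> {b. b permutes ?B})
      {p. p permutes ?A \<union> ?B \<and> p ` ?A = ?A}"
    by (rule bij_betw_compose_disjoint_permutes) auto
  have bij': "bij_betw (\<lambda>(a, b). a \<circ> b) ?dom ?L"
  proof (rule bij_betw_subset[OF bij])
    have fix1: "(a \<circ> b) 1 = 1 \<longleftrightarrow> a 1 = 1" if "b permutes ?B" for a b :: "nat \<Rightarrow> nat"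
      using agree[OF that, of 1 a] assms by simp
    have "?dom = {x \<in> {a. a permutes ?A} \<times> {b. b permutes ?B}.
        (\<lambda>(a, b). a \<circ> b) x \<in> {p. p 1 = 1}}"
    proof (rule set_eqI, clarify)
      fix a b
      show "(a, b) \<in> ?dom \<longleftrightarrow> (a, b) \<in> {x \<in> {a. a permutes ?A} \<times> {b. b permutes ?B}.
          (\<lambda>(a, b). a \<circ> b) x \<in> {p. p 1 = 1}}"
        using fix1[of b a] assms unfolding perms_fixing_1_def by auto
    qed
    then have "(\<lambda>(a, b). a \<circ> b) ` ?dom =
        (\<lambda>(a, b). a \<circ> b) ` ({a. a permutes ?A} \<times> {b. b permutes ?B}) \<inter> {p. p 1 = 1}"
      by blast
    then show "(\<lambda>(a, b). a \<circ> b) ` ?dom = ?L"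
      unfolding L using bij by (simp add: bij_betw_def)
  qed (auto simp: perms_fixing_1_def)
  have w: "?w (a \<circ> b) = q ^ card (split_points k a)" if b: "b permutes ?B" for a b
  proof -
    have "(a \<circ> b) ` {1..j} = a ` {1..j}" if "j < k" for j
      by (rule image_cong) (use agree[OF b] that in auto)
    moreover have "(a \<circ> b) (Suc j) = a (Suc j)" if "j < k" for j
      using agree[OF b, of "Suc j" a] that by simp
    ultimately have "j \<in> split_points n (a \<circ> b) \<and> j < k \<longleftrightarrow> j \<in> split_points k a" for j
      using assms by (cases "j < k") (auto simp: split_points_def simp del: o_apply)
    then have "{j \<in> split_points n (a \<circ> b). j < k} = split_points k a"
      by blast
    then show ?thesis by simp
  qed
  have "sum ?w ?L = (\<Sum>(a, b) \<in> ?dom. q ^ card (split_points k a))"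
    unfolding sum.reindex_bij_betw[OF bij', symmetric]
    by (rule sum.cong) (use w in auto)
  also have "\<dots> = (\<Sum>a \<in> perms_fixing_1 k. \<Sum>b | b permutes ?B. q ^ card (split_points k a))"
    by (rule sum.cartesian_product[symmetric])
  also have "\<dots> = ?r"
    by (simp add: card_permutations[OF refl] sum_distrib_left mult.commute)
  finally show ?thesis .
qed

text \<open>
  Every permutation counted by \<open>split_fps q\<close> contributes \<open>1\<close> to the first term, and once for each of its
  split points to the second, where it is cut into the prefix, the fixed point after it (the factor
  \<open>fps_X\<close>) and the rest.
\<close>

lemma split_fps_recurrence:
  fixes q :: "'a::comm_ring_1"
  shows "split_fps q = fps_X * fact_fps + fps_const (q - 1) * (split_fps q * (fps_X * fact_fps))"
proof (rule fps_ext)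
  fix n
  let ?H = "\<lambda>k. \<Sum>a \<in> perms_fixing_1 k. q ^ card (split_points k a)"
  let ?F = "fps_X * fact_fps :: 'a fps"
  have F: "fps_nth ?F m = (if m = 0 then 0 else of_nat (fact (m - 1)))" for m
    by (auto simp: fact_fps_def)
  have H: "fps_nth (split_fps q) k = ?H k" for k
    by (simp add: split_fps_def)
  have fin: "finite (split_points n p)" for p
    by (simp add: split_points_def)
  have "?H n = (\<Sum>p \<in> perms_fixing_1 n.
      1 + (q - 1) * (\<Sum>k \<in> split_points n p. q ^ card {j \<in> split_points n p. j < k}))"
    by (rule sum.cong) (use power_card_eq_sum_power_card_less[OF fin] in auto)
  also have "\<dots> = fps_nth ?F n + (q - 1) * (\<Sum>p \<in> perms_fixing_1 n.
      \<Sum>k | k \<in> {1..<n} \<and> k \<in> split_points n p. q ^ card {j \<in> split_points n p. j < k})"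
  proof -
    have "split_points n p = {k. k \<in> {1..<n} \<and> k \<in> split_points n p}" for p
      by (auto simp: split_points_def)
    then show ?thesis
      unfolding F by (simp add: sum.distrib sum_distrib_left card_perms_fixing_1)
  qed
  also have "(\<Sum>p \<in> perms_fixing_1 n.
      \<Sum>k | k \<in> {1..<n} \<and> k \<in> split_points n p. q ^ card {j \<in> split_points n p. j < k}) =
    (\<Sum>k \<in> {1..<n}. ?H k * of_nat (fact (n - k - 1)))"
    unfolding sum.swap_restrict[OF finite_perms_fixing_1 finite_atLeastLessThan]
    by (rule sum.cong) (use sum_perms_split_at in auto)
  also have "\<dots> = (\<Sum>k = 0..n. fps_nth (split_fps q) k * fps_nth ?F (n - k))"
    \<comment> \<open>The added summands vanish: \<open>k = 0\<close> by the convention on the empty permutation, and \<open>k = n\<close>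
       because \<open>?F\<close> has no constant term.\<close>
    by (rule sum.mono_neutral_cong_left)
      (auto simp: F H fact_fps_def perms_fixing_1_def)
  also have "\<dots> = fps_nth (split_fps q * ?F) n"
    by (simp only: fps_mult_nth)
  finally show "fps_nth (split_fps q) n = fps_nth (?F + fps_const (q - 1) * (split_fps q * ?F)) n"
    unfolding H[of n] by (simp only: fps_add_nth fps_mult_left_const_nth)
qed

section \<open>The generating function\<close>

lemma mesh12_fps_eq_split_fps:
  fixes q :: "'a::comm_ring_1"
  assumes R: "R = {(0,0), (0,1), (0,2), (1,0), (1,2), (2,0), (2,1)}"
  shows "mesh12_fps R q = fact_fps - fps_X * fact_fps + split_fps q"
proof (rule fps_ext)
  fix n
  let ?S = "{p. p permutes {1..n}}" and ?P = "perms_fixing_1 n"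
  have fin: "finite ?S" by (rule finite_permutations) simp
  have sub: "?P \<subseteq> ?S" by (auto simp: perms_fixing_1_def)
  have rest: "q ^ mesh12_count R n p = 1" if "p \<in> ?S - ?P" for p
    using that mesh12_count_eq_card_split_points[OF R, of p n]
    by (auto simp: perms_fixing_1_def split_points_def)
  have "(\<Sum>p \<in> ?S. q ^ mesh12_count R n p) =
      (\<Sum>p \<in> ?S - ?P. q ^ mesh12_count R n p) + (\<Sum>p \<in> ?P. q ^ mesh12_count R n p)"
    by (rule sum.subset_diff[OF sub fin])
  also have "(\<Sum>p \<in> ?S - ?P. q ^ mesh12_count R n p) = of_nat (card (?S - ?P))"
    using rest by simp
  also have "\<dots> = of_nat (card ?S) - of_nat (card ?P)"
    using card_Diff_subset[OF finite_perms_fixing_1 sub] card_mono[OF fin sub]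
    by (simp add: of_nat_diff)
  also have "(\<Sum>p \<in> ?P. q ^ mesh12_count R n p) = (\<Sum>p \<in> ?P. q ^ card (split_points n p))"
    by (rule sum.cong)
      (auto simp: perms_fixing_1_def mesh12_count_eq_card_split_points[OF R])
  finally show "fps_nth (mesh12_fps R q) n = fps_nth (fact_fps - fps_X * fact_fps + split_fps q) n"
    by (simp add: mesh12_fps_def split_fps_def fact_fps_def card_permutations[OF refl]
        card_perms_fixing_1)
qed

theorem theorem3p2:
  fixes q :: "'a::field" and R :: "(nat \<times> nat) set"
  assumes "R = {(0,0), (0,1), (0,2), (1,0), (1,2), (2,0), (2,1)}"
  shows "mesh12_fps R q =
    (1 - fps_X + fps_X / (1 + fps_X * fps_const (1 - q) * fact_fps)) * fact_fps"
proof -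
  let ?F = "fact_fps :: 'a fps"
  let ?D = "1 + fps_X * fps_const (1 - q) * ?F"
  have D0: "fps_nth ?D 0 \<noteq> 0" by (simp add: mult.assoc)
  have neg: "fps_const (q - 1) = - fps_const (1 - q)" by simp
  have "split_fps q * ?D = fps_X * ?F"
    using split_fps_recurrence[of q] unfolding neg
    by (simp add: algebra_simps del: fps_const_neg fps_const_sub)
  then have "split_fps q * (?D * inverse ?D) = fps_X * ?F * inverse ?D"
    by (simp add: mult.assoc[symmetric])
  then have "split_fps q = fps_X / ?D * ?F"
    using D0 by (simp add: inverse_mult_eq_1' fps_divide_unit mult_ac)
  then show ?thesis
    unfolding mesh12_fps_eq_split_fps[OF assms] by (simp add: algebra_simps)
qed

end
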